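(* Let $\mathcal{I}=(S,w,a)$ be an intersection schema, with associated polynomials $q_i(N)$, $i\ge 0$. Then for every nonnegative integer $N$ the following identity of formal power series in $x$ holds: $$\left(\sum_{i=0}^{\infty}q_i(1)x^i\right)^N=\sum_{i=0}^{\infty}q_i(N)x^i.$$
   Context: A weighted set is a (finite or infinite) set $S$ with a weight function $w:S\to\mathbb{Z}^+$ (positive integers) such that for every $W$ there are only finitely many $x\in S$ with $w(x)\le W$. $LCG(S)$ denotes the set of (finite, nonempty, simple) connected graphs each of whose vertices is labelled by an element of $S$ (labels may repeat), where two such graphs are considered the same if there is a graph isomorphism between them preserving labels. The weight $w(g)$ of $g\in LCG(S)$ is the sum of the weights of its vertex labels. An intersection schema is a weighted set $S$ together with an arbitrary function $a:LCG(S)\to\mathbb{C}$. Given an intersection schema, for $i\ge1$ define the polynomial $$q_i(N)=\sum_{r=1}^{\infty}\ \sum_{(g_1,\dots,g_r)}\frac{1}{r!}\,a(g_1)a(g_2)\cdots a(g_r)\,N^r,$$ where the inner sum is over all ordered $r$-tuples $(g_1,\dots,g_r)$ of elements of $LCG(S)$ with $\sum_{j=1}^r w(g_j)=i$ (a finite sum overall), and set $q_0(N)=1$. *)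

theory Defs
  imports "HOL-Computational_Algebra.Computational_Algebra"
begin

definition weighted_set :: "'s set \<Rightarrow> ('s \<Rightarrow> nat) \<Rightarrow> bool" where
  "weighted_set S w \<longleftrightarrow>
     (\<forall>x\<in>S. 0 < w x) \<and> (\<forall>W. finite {x \<in> S. w x \<le> W})"

text \<open>Vertices are natural numbers; this loses nothing, as finite graphs are only considered
  up to isomorphism. The values of the labelling outside the vertex set are irrelevant.\<close>

datatype 's lgraph =
  LGraph (verts: "nat set") (edges: "nat set set") (label: "nat \<Rightarrow> 's")

definition connected_lgraphs :: "'s set \<Rightarrow> 's lgraph set" where
  "connected_lgraphs S =
     {G. finite (verts G) \<and> verts G \<noteq> {} \<and>
         edges G \<subseteq> {{u, v} |u v. u \<in> verts G \<and> v \<in> verts G \<and> u \<noteq> v} \<and>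
         (\<forall>u\<in>verts G. \<forall>v\<in>verts G. (u, v) \<in> {(x, y). {x, y} \<in> edges G}\<^sup>*) \<and>
         label G ` verts G \<subseteq> S}"

definition lgraph_iso :: "'s lgraph \<Rightarrow> 's lgraph \<Rightarrow> bool" where
  "lgraph_iso G H \<longleftrightarrow>
     (\<exists>f. bij_betw f (verts G) (verts H) \<and>
          (\<forall>u\<in>verts G. \<forall>v\<in>verts G. {u, v} \<in> edges G \<longleftrightarrow> {f u, f v} \<in> edges H) \<and>
          (\<forall>u\<in>verts G. label H (f u) = label G u))"

definition iso_rel :: "'s set \<Rightarrow> ('s lgraph \<times> 's lgraph) set" where
  "iso_rel S = {(G, H). G \<in> connected_lgraphs S \<and> H \<in> connected_lgraphs S \<and> lgraph_iso G H}"

definition LCG :: "'s set \<Rightarrow> 's lgraph set set" where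
  "LCG S = connected_lgraphs S // iso_rel S"

definition lgraph_weight :: "('s \<Rightarrow> nat) \<Rightarrow> 's lgraph \<Rightarrow> nat" where
  "lgraph_weight w G = (\<Sum>v\<in>verts G. w (label G v))"

text \<open>The weight of an isomorphism class is the common weight of its members;
  see \<open>class_weight_eq\<close> below.\<close>

definition class_weight :: "('s \<Rightarrow> nat) \<Rightarrow> 's lgraph set \<Rightarrow> nat" where
  "class_weight w g = the_elem (lgraph_weight w ` g)"

definition tuples :: "'s set \<Rightarrow> ('s \<Rightarrow> nat) \<Rightarrow> nat \<Rightarrow> nat \<Rightarrow> 's lgraph set list set" where
  "tuples S w r i =
     {gs. length gs = r \<and> set gs \<subseteq> LCG S \<and> sum_list (map (class_weight w) gs) = i}"

text \<open>Since all weights are positive, there are no \<open>r\<close>-tuples of total weight \<open>i\<close> when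
  \<open>r > i\<close>, so the sum over all \<open>r \<ge> 1\<close> stops at \<open>r = i\<close>; the inner sums are finite. See
  \<open>tuples_empty\<close> and \<open>finite_tuples\<close> below.\<close>

definition q :: "'s set \<Rightarrow> ('s \<Rightarrow> nat) \<Rightarrow> ('s lgraph set \<Rightarrow> complex) \<Rightarrow> nat \<Rightarrow> complex poly" where
  "q S w a i =
     (if i = 0 then 1
      else \<Sum>r=1..i. \<Sum>gs\<in>tuples S w r i. monom (1 / fact r * prod_list (map a gs)) r)"

lemma lgraph_iso_refl: "lgraph_iso G G"
  unfolding lgraph_iso_def by (intro exI[of _ id]) auto

lemma lgraph_iso_sym:
  assumes "lgraph_iso G H" shows "lgraph_iso H G"
proof -
  obtain f where f: "bij_betw f (verts G) (verts H)"
    "\<And>u v. u \<in> verts G \<Longrightarrow> v \<in> verts G \<Longrightarrow> {u, v} \<in> edges G \<longleftrightarrow> {f u, f v} \<in> edges H"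
    "\<And>u. u \<in> verts G \<Longrightarrow> label H (f u) = label G u"
    using assms unfolding lgraph_iso_def by blast
  define h where "h = inv_into (verts G) f"
  have h: "bij_betw h (verts H) (verts G)"
    unfolding h_def by (rule bij_betw_inv_into[OF f(1)])
  have hin: "h y \<in> verts G" if "y \<in> verts H" for y
    using h that by (auto simp: bij_betw_def)
  have fh: "f (h y) = y" if "y \<in> verts H" for y
    unfolding h_def by (rule bij_betw_inv_into_right[OF f(1) that])
  show ?thesis
    unfolding lgraph_iso_def
  proof (intro exI[of _ h] conjI ballI)
    fix u v assume "u \<in> verts H" "v \<in> verts H"
    then show "{u, v} \<in> edges H \<longleftrightarrow> {h u, h v} \<in> edges G"
      using f(2)[of "h u" "h v"] hin fh by simp
  next
    fix u assume "u \<in> verts H"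
    then show "label G (h u) = label H u"
      using f(3)[of "h u"] hin fh by simp
  qed (rule h)
qed

lemma lgraph_iso_trans:
  assumes "lgraph_iso G H" "lgraph_iso H K" shows "lgraph_iso G K"
proof -
  obtain f where f: "bij_betw f (verts G) (verts H)"
    "\<And>u v. u \<in> verts G \<Longrightarrow> v \<in> verts G \<Longrightarrow> {u, v} \<in> edges G \<longleftrightarrow> {f u, f v} \<in> edges H"
    "\<And>u. u \<in> verts G \<Longrightarrow> label H (f u) = label G u"
    using assms(1) unfolding lgraph_iso_def by blast
  obtain h where h: "bij_betw h (verts H) (verts K)"
    "\<And>u v. u \<in> verts H \<Longrightarrow> v \<in> verts H \<Longrightarrow> {u, v} \<in> edges H \<longleftrightarrow> {h u, h v} \<in> edges K"
    "\<And>u. u \<in> verts H \<Longrightarrow> label K (h u) = label H u"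
    using assms(2) unfolding lgraph_iso_def by blast
  have fin: "f y \<in> verts H" if "y \<in> verts G" for y
    using f(1) that by (auto simp: bij_betw_def)
  show ?thesis
    unfolding lgraph_iso_def
  proof (intro exI[of _ "h \<circ> f"] conjI ballI)
    show "bij_betw (h \<circ> f) (verts G) (verts K)"
      by (rule bij_betw_trans[OF f(1) h(1)])
  next
    fix u v assume "u \<in> verts G" "v \<in> verts G"
    then show "{u, v} \<in> edges G \<longleftrightarrow> {(h \<circ> f) u, (h \<circ> f) v} \<in> edges K"
      using f(2) h(2) fin by simp
  next
    fix u assume "u \<in> verts G"
    then show "label K ((h \<circ> f) u) = label G u"
      using f(3) h(3) fin by simp
  qed
qed

lemma equiv_iso_rel: "equiv (connected_lgraphs S) (iso_rel S)"
proof (rule equivI)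
  show "iso_rel S \<subseteq> connected_lgraphs S \<times> connected_lgraphs S"
    by (auto simp: iso_rel_def)
  show "refl_on (connected_lgraphs S) (iso_rel S)"
    by (auto simp: refl_on_def iso_rel_def lgraph_iso_refl)
  show "sym (iso_rel S)"
    by (auto simp: sym_def iso_rel_def lgraph_iso_sym)
  show "trans (iso_rel S)"
    by (auto simp: trans_def iso_rel_def intro: lgraph_iso_trans)
qed

lemma lgraph_weight_iso:
  assumes "lgraph_iso G H" shows "lgraph_weight w G = lgraph_weight w H"
proof -
  obtain f where f: "bij_betw f (verts G) (verts H)"
    "\<And>u. u \<in> verts G \<Longrightarrow> label H (f u) = label G u"
    using assms unfolding lgraph_iso_def by blast
  show ?thesis
    unfolding lgraph_weight_def
    using sum.reindex_bij_betw[OF f(1), of "\<lambda>v. w (label H v)"] f(2) by simp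
qed

lemma LCG_memberD:
  assumes "g \<in> LCG S" "G \<in> g"
  shows "G \<in> connected_lgraphs S" "g = iso_rel S `` {G}"
proof -
  obtain H where H: "g = iso_rel S `` {H}"
    using assms(1) unfolding LCG_def by (rule quotientE)
  with assms(2) have HG: "(H, G) \<in> iso_rel S" by simp
  then show "G \<in> connected_lgraphs S" by (simp add: iso_rel_def)
  show "g = iso_rel S `` {G}"
    unfolding H by (rule equiv_class_eq[OF equiv_iso_rel HG])
qed

lemma LCG_nonempty:
  assumes "g \<in> LCG S" shows "g \<noteq> {}"
  using in_quotient_imp_non_empty[OF equiv_iso_rel] assms unfolding LCG_def .

lemma class_weight_eq:
  assumes "g \<in> LCG S" "G \<in> g"
  shows "class_weight w g = lgraph_weight w G"
proof -
  define n where "n = lgraph_weight w G"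
  have "lgraph_weight w H = n" if "H \<in> g" for H
  proof -
    have "H \<in> iso_rel S `` {G}"
      using LCG_memberD(2)[OF assms] that by (rule subst)
    then have "lgraph_iso G H" by (simp add: iso_rel_def)
    from lgraph_weight_iso[OF this] show ?thesis by (simp add: n_def)
  qed
  then have "lgraph_weight w ` g = {n}" using assms(2) by auto
  then show ?thesis by (simp add: class_weight_def n_def)
qed

lemma card_verts_le_weight:
  assumes "weighted_set S w" "G \<in> connected_lgraphs S"
  shows "card (verts G) \<le> lgraph_weight w G"
proof -
  have "(\<Sum>v\<in>verts G. 1) \<le> (\<Sum>v\<in>verts G. w (label G v))"
  proof (rule sum_mono)
    fix v assume "v \<in> verts G"
    then have "label G v \<in> S"
      using assms(2) by (simp add: connected_lgraphs_def image_subset_iff)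
    then show "1 \<le> w (label G v)" using assms(1) by (simp add: weighted_set_def Suc_le_eq)
  qed
  then show ?thesis by (simp add: lgraph_weight_def)
qed

lemma class_weight_pos:
  assumes "weighted_set S w" "g \<in> LCG S"
  shows "0 < class_weight w g"
proof -
  obtain G where G: "G \<in> g" using LCG_nonempty[OF assms(2)] by auto
  have GC: "G \<in> connected_lgraphs S" using LCG_memberD(1)[OF assms(2) G] .
  then have "0 < card (verts G)"
    by (simp add: connected_lgraphs_def card_gt_0_iff)
  also have "\<dots> \<le> lgraph_weight w G" by (rule card_verts_le_weight[OF assms(1) GC])
  also have "\<dots> = class_weight w g" by (rule class_weight_eq[OF assms(2) G, symmetric])
  finally show ?thesis .
qed

lemma length_le_weight:
  assumes "weighted_set S w" "set gs \<subseteq> LCG S"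
  shows "length gs \<le> sum_list (map (class_weight w) gs)"
  using assms(2)
proof (induction gs)
  case (Cons g gs)
  have "0 < class_weight w g"
    using class_weight_pos[OF assms(1)] Cons.prems by simp
  moreover have "length gs \<le> sum_list (map (class_weight w) gs)"
    using Cons.IH Cons.prems by simp
  ultimately show ?case by simp
qed simp

lemma tuples_empty:
  assumes "weighted_set S w" "i < r"
  shows "tuples S w r i = {}"
proof -
  have "gs \<notin> tuples S w r i" for gs
    using length_le_weight[OF assms(1), of gs] assms(2) by (auto simp: tuples_def)
  then show ?thesis by blast
qed

lemma exists_canonical:
  assumes "G \<in> connected_lgraphs S"
  shows "\<exists>H. H \<in> connected_lgraphs S \<and> lgraph_iso G H \<and> verts H = {..<card (verts G)} \<and>
             label H \<in> extensional {..<card (verts G)}"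
proof -
  define n where "n = card (verts G)"
  have fin: "finite (verts G)" using assms by (simp add: connected_lgraphs_def)
  obtain f where f: "bij_betw f (verts G) {..<n}"
    using ex_bij_betw_finite_nat[OF fin] by (auto simp: n_def atLeast0LessThan)
  define h where "h = inv_into (verts G) f"
  define H where "H = LGraph {..<n} ((`) f ` edges G) (restrict (label G \<circ> h) {..<n})"
  have inj: "inj_on f (verts G)" and img: "f ` verts G = {..<n}"
    using f by (auto simp: bij_betw_def)
  have hf: "h (f v) = v" if "v \<in> verts G" for v
    using that inj by (simp add: h_def)
  have fv: "f v < n" if "v \<in> verts G" for v
    using that img by auto
  have E: "edges G \<subseteq> {{u, v} |u v. u \<in> verts G \<and> v \<in> verts G \<and> u \<noteq> v}"
    using assms by (simp add: connected_lgraphs_def)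
  then have EP: "edges G \<subseteq> Pow (verts G)" by blast
  have edge_iff: "{u, v} \<in> edges G \<longleftrightarrow> {f u, f v} \<in> edges H"
    if uv: "u \<in> verts G" "v \<in> verts G" for u v
  proof
    assume "{u, v} \<in> edges G"
    then have "f ` {u, v} \<in> edges H" unfolding H_def by (simp only: lgraph.sel) (rule imageI)
    then show "{f u, f v} \<in> edges H" by simp
  next
    assume "{f u, f v} \<in> edges H"
    then obtain e where e: "e \<in> edges G" "f ` {u, v} = f ` e" by (auto simp: H_def)
    have "e \<subseteq> verts G" using e(1) EP by auto
    then have "{u, v} = e"
      using inj_on_image_eq_iff[OF inj, of "{u, v}" e] e(2) uv by simp
    then show "{u, v} \<in> edges G" using e(1) by simp
  qed
  have iso: "lgraph_iso G H"
    unfolding lgraph_iso_def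
    using f edge_iff hf fv by (intro exI[of _ f]) (auto simp: H_def)
  have conn: "(f u, f v) \<in> {(x, y). {x, y} \<in> edges H}\<^sup>*"
    if "(u, v) \<in> {(x, y). {x, y} \<in> edges G}\<^sup>*" for u v
    using that
  proof (induction rule: rtrancl_induct)
    case (step y z)
    then have yz: "{y, z} \<in> edges G" by simp
    then have "y \<in> verts G" "z \<in> verts G" using EP by auto
    then have "(f y, f z) \<in> {(x, y). {x, y} \<in> edges H}" using edge_iff yz by simp
    then show ?case by (rule rtrancl_into_rtrancl[OF step.IH])
  qed simp
  have "H \<in> connected_lgraphs S"
    unfolding connected_lgraphs_def mem_Collect_eq
  proof (intro conjI ballI)
    show "finite (verts H)" by (simp add: H_def)
    have "verts G \<noteq> {}" using assms by (simp add: connected_lgraphs_def)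
    then show "verts H \<noteq> {}" using img by (auto simp: H_def)
    show "edges H \<subseteq> {{u, v} |u v. u \<in> verts H \<and> v \<in> verts H \<and> u \<noteq> v}"
    proof
      fix e assume "e \<in> edges H"
      then obtain e' where e': "e' \<in> edges G" "e = f ` e'" by (auto simp: H_def)
      then obtain u v where uv: "e' = {u, v}" "u \<in> verts G" "v \<in> verts G" "u \<noteq> v"
        using E by blast
      have "e = {f u, f v}" using e' uv by simp
      moreover have "f u \<noteq> f v" using inj uv by (auto dest: inj_onD)
      ultimately show "e \<in> {{u, v} |u v. u \<in> verts H \<and> v \<in> verts H \<and> u \<noteq> v}"
        using fv uv by (auto simp: H_def)
    qed
    show "label H ` verts H \<subseteq> S"
    proof
      fix s assume "s \<in> label H ` verts H"
      then obtain x where "x < n" "s = label G (h x)" by (auto simp: H_def)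
      moreover from this obtain v where "v \<in> verts G" "x = f v" using img by blast
      ultimately show "s \<in> S" using hf assms by (auto simp: connected_lgraphs_def)
    qed
    fix x y assume "x \<in> verts H" "y \<in> verts H"
    then obtain u v where "u \<in> verts G" "v \<in> verts G" "x = f u" "y = f v"
      using img by (auto simp: H_def) (metis imageE lessThan_iff)
    then show "(x, y) \<in> {(x, y). {x, y} \<in> edges H}\<^sup>*"
      using conn assms by (auto simp: connected_lgraphs_def)
  qed
  then show ?thesis
    using iso by (intro exI[of _ H]) (auto simp: H_def n_def)
qed

lemma finite_LCG_weight:
  assumes "weighted_set S w"
  shows "finite {g \<in> LCG S. class_weight w g \<le> W}"
proof -
  define T where "T = {x \<in> S. w x \<le> W}"
  define C where "C = (\<Union>n\<le>W. (\<lambda>(E, l). LGraph {..<n} E l) `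
                        (Pow (Pow {..<n}) \<times> ({..<n} \<rightarrow>\<^sub>E T)))"
  have finT: "finite T" using assms by (simp add: T_def weighted_set_def)
  then have finC: "finite C"
    unfolding C_def by (intro finite_UN_I finite_imageI finite_cartesian_product)
      (auto intro!: finite_PiE)
  have "{g \<in> LCG S. class_weight w g \<le> W} \<subseteq> (\<lambda>H. iso_rel S `` {H}) ` C"
  proof
    fix g assume g: "g \<in> {g \<in> LCG S. class_weight w g \<le> W}"
    then have gL: "g \<in> LCG S" by simp
    obtain G where G: "G \<in> g" using LCG_nonempty[OF gL] by auto
    have GC: "G \<in> connected_lgraphs S" using LCG_memberD(1)[OF gL G] .
    obtain H where H: "H \<in> connected_lgraphs S" "lgraph_iso G H"
      "verts H = {..<card (verts G)}" "label H \<in> extensional {..<card (verts G)}"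
      using exists_canonical[OF GC] by blast
    have Hg: "H \<in> g" using LCG_memberD(2)[OF gL G] H(1,2) GC by (auto simp: iso_rel_def)
    have wH: "lgraph_weight w H \<le> W" using g class_weight_eq[OF gL Hg] by simp
    have card: "card (verts G) \<le> W"
      using card_verts_le_weight[OF assms H(1)] wH H(3) by simp
    have "label H v \<in> T" if "v \<in> verts H" for v
    proof -
      have "w (label H v) \<le> lgraph_weight w H"
        unfolding lgraph_weight_def using that H(3) by (intro member_le_sum) auto
      then show ?thesis using wH that H(1) by (auto simp: T_def connected_lgraphs_def)
    qed
    then have lab: "label H \<in> {..<card (verts G)} \<rightarrow>\<^sub>E T"
      using H(3,4) by (auto simp: PiE_def)
    have "edges H \<subseteq> {{u, v} |u v. u \<in> verts H \<and> v \<in> verts H \<and> u \<noteq> v}"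
      using H(1) by (simp add: connected_lgraphs_def)
    then have edg: "edges H \<in> Pow (Pow {..<card (verts G)})"
      unfolding H(3) by blast
    have "H = (\<lambda>(E, l). LGraph {..<card (verts G)} E l) (edges H, label H)"
      using H(3) by (cases H) simp
    then have "H \<in> C" unfolding C_def using card lab edg by blast
    then show "g \<in> (\<lambda>H. iso_rel S `` {H}) ` C"
      using LCG_memberD(2)[OF gL Hg] by blast
  qed
  then show ?thesis using finC by (meson finite_imageI finite_subset)
qed

lemma finite_tuples:
  assumes "weighted_set S w"
  shows "finite (tuples S w r i)"
proof -
  have "tuples S w r i \<subseteq> {gs. set gs \<subseteq> {g \<in> LCG S. class_weight w g \<le> i} \<and> length gs = r}"
    by (auto simp: tuples_def intro!: member_le_sum_list)
  then show ?thesis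
    using finite_lists_length_eq[OF finite_LCG_weight[OF assms]] finite_subset by blast
qed

end

theory Submission imports Defs begin

text \<open>
  Let \<open>A(x)\<close> be the generating function of the isomorphism classes of labelled connected graphs,
  in which each class \<open>g\<close> contributes \<open>a(g) x^(w(g))\<close>. Expanding a power \<open>A(x)\<^sup>r\<close> gives one term for
  each ordered \<open>r\<close>-tuple of classes (\<open>fps_power_nth_eq_sum_lists\<close>), so the inner sum that defines
  \<open>q\<close> is \<open>A(x)\<^sup>r / r!\<close> read off at \<open>x\<^sup>i\<close>. Summing over \<open>r\<close> with the factor \<open>N\<^sup>r\<close> produces
  \<open>\<Sum>\<^sub>i q\<^sub>i(N) x\<^sup>i = exp(N A(x))\<close> (\<open>fps_q_eq_exp\<close>), where the composition makes sense because
  positivity of the weights forces \<open>A(0) = 0\<close>. The identity is then the law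
  \<open>exp(A)\<^sup>N = exp(N A)\<close>. The graphs themselves enter through two facts: there are finitely many
  classes of each weight, and none of weight \<open>0\<close>.
\<close>

definition weight_gf :: "'g set \<Rightarrow> ('g \<Rightarrow> nat) \<Rightarrow> ('g \<Rightarrow> 'c) \<Rightarrow> 'c::comm_semiring_1 fps" where
  "weight_gf X v f = Abs_fps (\<lambda>n. \<Sum>x | x \<in> X \<and> v x = n. f x)"

text \<open>
  The coefficient of a product is a convolution: choosing a factor's term \<open>x\<close> of weight \<open>k\<close> and a
  tuple \<open>xs\<close> of weight \<open>i - k\<close> is the same as choosing the tuple \<open>x # xs\<close> of weight \<open>i\<close>.
  Finiteness in each weight is what allows the nested sums to be merged into one.
\<close>
lemma fps_power_nth_eq_sum_lists:
  fixes f :: "'g \<Rightarrow> 'c::comm_semiring_1"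
  assumes fin: "\<And>n. finite {x \<in> X. v x = n}"
  shows "weight_gf X v f ^ r $ i =
    (\<Sum>xs | length xs = r \<and> set xs \<subseteq> X \<and> sum_list (map v xs) = i. prod_list (map f xs))"
proof -
  define T where
    "T r i = {xs. length xs = r \<and> set xs \<subseteq> X \<and> sum_list (map v xs) = i}" for r i
  have T_Suc: "T (Suc r) i =
      (\<lambda>(k, x, xs). x # xs) ` (SIGMA k:{0..i}. {x \<in> X. v x = k} \<times> T r (i - k))" for r i
  proof (intro equalityI subsetI)
    fix xs assume "xs \<in> T (Suc r) i"
    then obtain y ys where "xs = y # ys" "y \<in> X" "v y \<le> i" "ys \<in> T r (i - v y)"
      by (cases xs) (auto simp: T_def)
    then show "xs \<in> (\<lambda>(k, x, xs). x # xs) `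
        (SIGMA k:{0..i}. {x \<in> X. v x = k} \<times> T r (i - k))"
      by (intro image_eqI[of _ _ "(v y, y, ys)"]) auto
  qed (auto simp: T_def)
  have finT: "finite (T r i)" for r i
  proof (induction r arbitrary: i)
    case 0
    have "T 0 i \<subseteq> {[]}" by (auto simp: T_def)
    then show ?case by (rule finite_subset) simp
  next
    case (Suc r)
    show ?case
      unfolding T_Suc by (intro finite_imageI finite_SigmaI finite_cartesian_product fin Suc) simp
  qed
  have "weight_gf X v f ^ r $ i = (\<Sum>xs\<in>T r i. prod_list (map f xs))"
  proof (induction r arbitrary: i)
    case 0
    have "T 0 i = (if i = 0 then {[]} else {})" by (auto simp: T_def)
    then show ?case by simp
  next
    case (Suc r)
    have inj: "inj_on (\<lambda>(k, x, xs). x # xs)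
        (SIGMA k:{0..i}. {x \<in> X. v x = k} \<times> T r (i - k))"
      by (auto simp: inj_on_def)
    have "weight_gf X v f ^ Suc r $ i = (\<Sum>k=0..i. weight_gf X v f $ k * weight_gf X v f ^ r $ (i - k))"
      by (simp add: fps_mult_nth)
    also have "\<dots> = (\<Sum>k=0..i. \<Sum>(x, xs)\<in>{x \<in> X. v x = k} \<times> T r (i - k).
        f x * prod_list (map f xs))"
      by (simp add: Suc.IH) (simp add: weight_gf_def sum_product sum.cartesian_product)
    also have "\<dots> = (\<Sum>(k, x, xs)\<in>(SIGMA k:{0..i}. {x \<in> X. v x = k} \<times> T r (i - k)).
        f x * prod_list (map f xs))"
      by (subst sum.Sigma) (auto intro!: finite_cartesian_product fin finT)
    also have "\<dots> = (\<Sum>xs\<in>T (Suc r) i. prod_list (map f xs))"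
      unfolding T_Suc by (subst sum.reindex[OF inj]) (auto intro!: sum.cong)
    finally show ?case .
  qed
  then show ?thesis by (simp add: T_def)
qed

text \<open>
  The factor \<open>1 / r!\<close> in \<open>q\<close> is the one in the exponential series. The composition at \<open>x\<^sup>i\<close> only
  involves the powers \<open>r \<le> i\<close>, which is the range of the sum that defines \<open>q\<close>.
\<close>
lemma fps_q_eq_exp:
  fixes a :: "'s lgraph set \<Rightarrow> complex"
  assumes "weighted_set S w"
  shows "Abs_fps (\<lambda>i. poly (q S w a i) c) = fps_exp c oo weight_gf (LCG S) (class_weight w) a"
proof (rule fps_ext)
  fix i
  let ?A = "weight_gf (LCG S) (class_weight w) a"
  have fin: "finite {g \<in> LCG S. class_weight w g = n}" for n
    by (rule finite_subset[OF _ finite_LCG_weight[OF assms, of n]]) auto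
  have A_power: "?A ^ r $ i = (\<Sum>gs\<in>tuples S w r i. prod_list (map a gs))" for r
    by (simp add: fps_power_nth_eq_sum_lists[OF fin] tuples_def)
  have "poly (q S w a i) c = (\<Sum>r=0..i. c ^ r / fact r * ?A ^ r $ i)"
  proof (cases "i = 0")
    case True
    then show ?thesis by (simp add: q_def)
  next
    case False
    have "poly (q S w a i) c = (\<Sum>r=1..i. c ^ r / fact r * ?A ^ r $ i)"
      using False
      by (simp add: q_def poly_sum poly_monom A_power sum_distrib_left mult_ac)
    \<comment> \<open>The empty tuple has weight \<open>0 < i\<close>, so the sum may as well start at \<open>r = 0\<close>.\<close>
    also have "\<dots> = (\<Sum>r=0..i. c ^ r / fact r * ?A ^ r $ i)"
      using False by (intro sum.mono_neutral_left) (auto simp: not_less_eq_eq)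
    finally show ?thesis .
  qed
  then show "Abs_fps (\<lambda>i. poly (q S w a i) c) $ i = (fps_exp c oo ?A) $ i"
    by (simp add: fps_compose_nth)
qed

theorem theorem4p5:
  fixes S :: "'s set" and w :: "'s \<Rightarrow> nat" and a :: "'s lgraph set \<Rightarrow> complex" and N :: nat
  assumes "weighted_set S w"
  shows "(Abs_fps (\<lambda>i. poly (q S w a i) 1)) ^ N = Abs_fps (\<lambda>i. poly (q S w a i) (of_nat N))"
proof -
  let ?A = "weight_gf (LCG S) (class_weight w) a"
  have "{g. g \<in> LCG S \<and> class_weight w g = 0} = {}"
    using class_weight_pos[OF assms] by fastforce
  then have A_0: "?A $ 0 = 0" unfolding weight_gf_def by (simp only: fps_nth_Abs_fps sum.empty)
  have "(fps_exp 1 oo ?A) ^ N = fps_exp 1 ^ N oo ?A"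
    by (rule fps_compose_power[OF A_0])
  also have "\<dots> = fps_exp (of_nat N) oo ?A"
    by (simp add: fps_exp_power_mult)
  finally show ?thesis by (simp add: fps_q_eq_exp[OF assms])
qed

end
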